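(* Let $u=u(x,t)$ be a smooth positive solution of the Cauchy problem for the DLSS equation $$\partial_t u=-\left(u\left(\ln u\right)_{xx}\right)_{xx},\qquad x\in\mathbb{R},\ t>0,$$ with initial data $u(\cdot,0)=u_0$ satisfying $$\int_{\mathbb{R}} u_0\,\mathrm{d}x = 1,\qquad \int_{\mathbb{R}} x\,u_0\,\mathrm{d}x = 0,\qquad \int_{\mathbb{R}} x^2u_0\,\mathrm{d}x = \Theta_0,$$ and $\mathcal{H}(u_0)<+\infty$. Then there exists a constant $C>0$, independent of $u$, such that $$\|u(t)-U_1(t)\|_{L^1(\mathbb{R})}\leq C\left(\mathcal{H}(u(t)\,|\,U_1(t))\right)^{1/2}\qquad\text{for all } t>0,$$ where $U_1(t)$ is the centered Gaussian density with the same second moment as $u(t)$, $$U_1(x,t)=\frac{1}{\sqrt{2\pi\Theta_t}}\exp\left(-\frac{x^2}{2\Theta_t}\right),\qquad \Theta_t=\int_{\mathbb{R}}x^2u(x,t)\,\mathrm{d}x.$$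
   Context: For a probability density $f$ on $\mathbb{R}$, $\mathcal{H}(f)=-\int_{\mathbb{R}}f\ln f\,\mathrm{d}x$ is the Boltzmann–Shannon entropy. If $G$ is the centered Gaussian density with the same second moment as $f$, the relative Boltzmann entropy is $\mathcal{H}(f|G)=\mathcal{H}(G)-\mathcal{H}(f)$. Solutions are understood to be sufficiently smooth and fast decaying in space for the standard integrations by parts to hold; in particular $u(t)$ has unit mass and finite second moment $\Theta_t$ for all $t>0$. *)

theory Defs
  imports "HOL-Probability.Distributions"
begin

text \<open>
  The Boltzmann--Shannon entropy \<open>-\<integral> f ln f\<close> as an extended real: an integral that diverges
  to plus or minus infinity keeps its sign, whereas the Bochner integral would return 0.
  At points with \<open>f x = 0\<close> the integrand is 0. If both parts diverge, the value is \<open>\<infinity>\<close>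
  (this cannot happen for a density with finite second moment).
\<close>

definition shannon_entropy :: "(real \<Rightarrow> real) \<Rightarrow> ereal" where
  "shannon_entropy f =
     enn2ereal (\<integral>\<^sup>+ x. ennreal (- (f x * ln (f x))) \<partial>lborel)
   - enn2ereal (\<integral>\<^sup>+ x. ennreal (f x * ln (f x)) \<partial>lborel)"

definition second_moment :: "(real \<Rightarrow> real) \<Rightarrow> real" where
  "second_moment f = (\<integral> x. x\<^sup>2 * f x \<partial>lborel)"

definition gaussian_of :: "(real \<Rightarrow> real) \<Rightarrow> real \<Rightarrow> real" where
  "gaussian_of f = normal_density 0 (sqrt (second_moment f))"

lemma gaussian_of_explicit:
  assumes "second_moment f \<ge> 0"
  shows "gaussian_of f x =
    1 / sqrt (2 * pi * second_moment f) * exp (- (x\<^sup>2 / (2 * second_moment f)))"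
  using assms by (simp add: gaussian_of_def normal_density_def)

definition relative_entropy :: "(real \<Rightarrow> real) \<Rightarrow> (real \<Rightarrow> real) \<Rightarrow> ereal" where
  "relative_entropy f G = shannon_entropy G - shannon_entropy f"

definition L1_dist :: "(real \<Rightarrow> real) \<Rightarrow> (real \<Rightarrow> real) \<Rightarrow> real" where
  "L1_dist f g = (\<integral> x. \<bar>f x - g x\<bar> \<partial>lborel)"

text \<open>The square root on the extended reals; only its values on \<open>[0, \<infinity>]\<close> matter.\<close>

definition ereal_sqrt :: "ereal \<Rightarrow> ereal" where
  "ereal_sqrt a = (if a = \<infinity> then \<infinity> else ereal (sqrt (real_of_ereal a)))"

text \<open>
  \<open>u\<close> is \<open>C\<^sup>\<infinity>\<close> on the open half plane \<open>t > 0\<close>; the function \<open>D i j\<close> is the partial derivative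
  of \<open>u\<close> of order \<open>i\<close> in \<open>x\<close> and order \<open>j\<close> in \<open>t\<close>.
\<close>

definition smooth_pos_time :: "(real \<Rightarrow> real \<Rightarrow> real) \<Rightarrow> bool" where
  "smooth_pos_time u \<longleftrightarrow>
    (\<exists>D :: nat \<Rightarrow> nat \<Rightarrow> real \<Rightarrow> real \<Rightarrow> real.
       (\<forall>x. \<forall>t>0. D 0 0 x t = u x t) \<and>
       (\<forall>i j. continuous_on (UNIV \<times> {0<..}) (\<lambda>(x, t). D i j x t)) \<and>
       (\<forall>i j x. \<forall>t>0.
          ((\<lambda>y. D i j y t) has_real_derivative D (Suc i) j x t) (at x) \<and>
          ((\<lambda>s. D i j x s) has_real_derivative D i (Suc j) x t) (at t)))"

definition DLSS_equation :: "(real \<Rightarrow> real \<Rightarrow> real) \<Rightarrow> bool" where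
  "DLSS_equation u \<longleftrightarrow>
    (\<forall>x. \<forall>t>0.
       deriv (\<lambda>s. u x s) t =
         - (deriv ^^ 2) (\<lambda>y. u y t * (deriv ^^ 2) (\<lambda>z. ln (u z t)) y) x)"

text \<open>
  A smooth positive solution of the Cauchy problem. Smoothness, positivity and the equation are
  required for \<open>t > 0\<close>. The initial datum is attained in \<open>L\<^sup>1\<close>; since the mass is conserved,
  this follows (Scheffe) when \<open>u\<close> is continuous up to \<open>t = 0\<close>. Of the spatial decay, only unit
  mass and finite second moment at positive times are required.
\<close>

definition DLSS_solution :: "(real \<Rightarrow> real \<Rightarrow> real) \<Rightarrow> (real \<Rightarrow> real) \<Rightarrow> bool" where
  "DLSS_solution u u0 \<longleftrightarrow>
     smooth_pos_time u \<and>
     (\<forall>x. \<forall>t>0. u x t > 0) \<and>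
     DLSS_equation u \<and>
     (\<forall>x. u x 0 = u0 x) \<and>
     ((\<lambda>t. L1_dist (\<lambda>x. u x t) u0) \<longlongrightarrow> 0) (at_right 0) \<and>
     (\<forall>t>0. has_bochner_integral lborel (\<lambda>x. u x t) 1 \<and>
            integrable lborel (\<lambda>x. x\<^sup>2 * u x t))"

end

theory Submission
  imports Defs
begin

text \<open>
  With \<open>G\<close> the centred Gaussian with the second moment of \<open>f\<close>, \<open>ln G\<close> is an affine function
  of \<open>x\<^sup>2\<close>, so \<open>\<integral> G ln G = \<integral> f ln G\<close> and the entropy difference is the Kullback--Leibler divergence
  \<open>K = \<integral> f ln (f / G)\<close>. The inequality is then of Csiszar--Kullback--Pinsker type and uses nothing
  about the equation. Pointwise, \<open>ln s \<le> s - 1\<close> at \<open>s = sqrt (G / f)\<close> gives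
  \<open>(sqrt f - sqrt G)\<^sup>2 \<le> f ln (f / G) - f + G\<close>; since \<open>f - G = (sqrt f - sqrt G) (sqrt f + sqrt G)\<close>,
  Young's inequality with parameter \<open>a\<close> gives \<open>\<parallel>f - G\<parallel> \<le> K / (2 a) + 2 a\<close>, and optimising in \<open>a\<close>
  yields the constant 2.
\<close>

lemma sqrt_diff_square_le_relative_entropy_density:
  fixes p q :: real
  assumes "p > 0" "q > 0"
  shows "(sqrt p - sqrt q)\<^sup>2 \<le> p * ln p - p * ln q - p + q"
proof -
  have "ln (sqrt q / sqrt p) \<le> sqrt q / sqrt p - 1"
    using assms by (intro ln_le_minus_one) auto
  then have "p * (ln (sqrt q / sqrt p)) \<le> p * (sqrt q / sqrt p - 1)"
    using assms by (intro mult_left_mono) auto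
  moreover have "ln (sqrt q / sqrt p) = (ln q - ln p) / 2"
    using assms by (simp add: ln_div ln_sqrt)
  moreover have "p * (sqrt q / sqrt p - 1) = sqrt p * sqrt q - p"
    using assms real_div_sqrt[of p]
    by (metis less_imp_le mult.right_neutral right_diff_distrib times_divide_eq_left times_divide_eq_right)
  ultimately have "p * (ln q - ln p) \<le> 2 * (sqrt p * sqrt q - p)"
    by simp
  then show ?thesis
    using assms by (simp add: power2_diff algebra_simps)
qed

lemma abs_diff_le_relative_entropy_density:
  fixes p q a :: real
  assumes "p > 0" "q > 0" "a > 0"
  shows "\<bar>p - q\<bar> \<le> (p * ln p - p * ln q - p + q) / (2 * a) + a * (p + q)"
proof -
  define d s where "d = \<bar>sqrt p - sqrt q\<bar>" and "s = sqrt p + sqrt q"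
  have d2: "d\<^sup>2 \<le> p * ln p - p * ln q - p + q"
    using sqrt_diff_square_le_relative_entropy_density[OF assms(1,2)] by (simp add: d_def)
  \<comment> \<open>Parallelogram identity: discarding \<open>d\<^sup>2\<close> bounds
    \<open>s\<^sup>2\<close> by a quantity whose integral is known from the two masses.\<close>
  have "s\<^sup>2 + d\<^sup>2 = 2 * (p + q)"
    using assms by (simp add: d_def s_def power2_sum power2_diff)
  then have s2: "s\<^sup>2 \<le> 2 * (p + q)"
    using zero_le_power2[of d] by linarith
  have "p - q = (sqrt p - sqrt q) * s"
    using assms by (simp add: s_def algebra_simps)
  then have "\<bar>p - q\<bar> = d * s"
    using assms by (simp add: abs_mult d_def s_def)
  also have "\<dots> \<le> d\<^sup>2 / (2 * a) + a * s\<^sup>2 / 2"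
  proof -
    have "0 \<le> (d - a * s)\<^sup>2 / (2 * a)"
      using assms by simp
    also have "\<dots> = d\<^sup>2 / (2 * a) + a * s\<^sup>2 / 2 - d * s"
      using assms by (simp add: power2_eq_square field_simps)
    finally show ?thesis by simp
  qed
  also have "\<dots> \<le> (p * ln p - p * ln q - p + q) / (2 * a) + a * (p + q)"
  proof (intro add_mono divide_right_mono d2)
    show "a * s\<^sup>2 / 2 \<le> a * (p + q)"
      using mult_left_mono[OF s2, of a] assms by simp
  qed (use assms in simp)
  finally show ?thesis .
qed

text \<open>The right-hand side is minimal at \<open>a = sqrt K / 2\<close>. For
  \<open>K = 0\<close> this value is not admissible, and \<open>a\<close> tends to 0
  instead.\<close>

lemma le_two_sqrt_if_Young:
  fixes L K :: real
  assumes Young: "\<And>a. a > 0 \<Longrightarrow> L \<le> K / (2 * a) + 2 * a" and "K \<ge> 0"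
  shows "L \<le> 2 * sqrt K"
proof (cases "K = 0")
  case True
  have "L \<le> 0 + e" if "e > 0" for e
    using Young[of "e / 2"] that True by simp
  then show ?thesis
    using True by (simp add: field_le_epsilon)
next
  case False
  with \<open>K \<ge> 0\<close> have "K > 0" by simp
  then have "K / (2 * (sqrt K / 2)) = sqrt K"
    by (simp add: real_div_sqrt)
  with Young[of "sqrt K / 2"] \<open>K > 0\<close> show ?thesis by simp
qed

lemma relative_entropy_ge_L1:
  fixes f g :: "real \<Rightarrow> real"
  assumes pos: "\<And>x. f x > 0" "\<And>x. g x > 0"
    and f: "has_bochner_integral lborel f 1" and g: "has_bochner_integral lborel g 1"
    and K: "has_bochner_integral lborel (\<lambda>x. f x * ln (f x) - f x * ln (g x)) K"
  shows "L1_dist f g \<le> 2 * sqrt K"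
proof (rule le_two_sqrt_if_Young)
  \<comment> \<open>Adding \<open>g - f\<close> leaves the integral at \<open>K\<close>, since both
    masses are 1, and makes the integrand pointwise nonnegative.\<close>
  have dens: "has_bochner_integral lborel (\<lambda>x. f x * ln (f x) - f x * ln (g x) - f x + g x) K"
    using has_bochner_integral_add[OF has_bochner_integral_diff[OF K f] g] by simp
  have "0 \<le> f x * ln (f x) - f x * ln (g x) - f x + g x" for x
    using sqrt_diff_square_le_relative_entropy_density[OF pos, of x x]
      zero_le_power2[of "sqrt (f x) - sqrt (g x)"] by linarith
  then show "K \<ge> 0"
    using dens integral_nonneg_AE[of "\<lambda>x. f x * ln (f x) - f x * ln (g x) - f x + g x" lborel]
    by (simp add: has_bochner_integral_iff)
  fix a :: real assume "a > 0"
  have "has_bochner_integral lborel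
      (\<lambda>x. (f x * ln (f x) - f x * ln (g x) - f x + g x) / (2 * a) + a * (f x + g x))
      (K / (2 * a) + a * (1 + 1))"
    by (intro has_bochner_integral_add has_bochner_integral_mult_right
        has_bochner_integral_divide_zero dens f g)
  moreover have "integrable lborel (\<lambda>x. \<bar>f x - g x\<bar>)"
    using f g by (auto simp: has_bochner_integral_iff)
  ultimately show "L1_dist f g \<le> K / (2 * a) + 2 * a"
    unfolding L1_dist_def has_bochner_integral_iff
    using abs_diff_le_relative_entropy_density[OF pos \<open>a > 0\<close>]
      integral_mono[of lborel "\<lambda>x. \<bar>f x - g x\<bar>"
        "\<lambda>x. (f x * ln (f x) - f x * ln (g x) - f x + g x) / (2 * a) + a * (f x + g x)"]
    by (simp add: mult.commute)
qed

text \<open>Integrability makes the integrals of the positive and negative parts both finite, so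
  their difference in the extended reals is a real one.\<close>

lemma shannon_entropy_eq_integral:
  assumes "integrable lborel (\<lambda>x. f x * ln (f x))"
  shows "shannon_entropy f = ereal (- (\<integral>x. f x * ln (f x) \<partial>lborel))"
proof -
  let ?h = "\<lambda>x. f x * ln (f x)"
  have fin: "(\<integral>\<^sup>+x. ennreal (?h x) \<partial>lborel) \<noteq> \<infinity>" "(\<integral>\<^sup>+x. ennreal (- ?h x) \<partial>lborel) \<noteq> \<infinity>"
    using assms by (auto simp: real_integrable_def)
  have enn: "enn2ereal e = ereal (enn2real e)" if "e \<noteq> \<infinity>" for e
    using that by (cases e) auto
  show ?thesis
    unfolding shannon_entropy_def real_lebesgue_integral_def[OF assms] enn[OF fin(1)] enn[OF fin(2)]
    by simp
qed

text \<open>Excludes the value \<open>\<infinity>\<close> of the entropy, for which the relative entropy would be \<open>- \<infinity>\<close>.\<close>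

lemma entropy_positive_part_finite:
  assumes pos: "\<And>x. f x > 0" "\<And>x. g x > 0"
    and "integrable lborel f" "integrable lborel g" "integrable lborel (\<lambda>x. f x * ln (g x))"
  shows "(\<integral>\<^sup>+x. ennreal (- (f x * ln (f x))) \<partial>lborel) < \<infinity>"
proof -
  \<comment> \<open>Dropping the square in the pointwise inequality leaves
    \<open>- f ln f \<le> ?b\<close>, and \<open>?b\<close> is integrable.\<close>
  let ?b = "\<lambda>x. g x - f x - f x * ln (g x)"
  have "- (f x * ln (f x)) \<le> \<bar>?b x\<bar>" for x
    using sqrt_diff_square_le_relative_entropy_density[OF pos, of x x]
      zero_le_power2[of "sqrt (f x) - sqrt (g x)"] by linarith
  then have "(\<integral>\<^sup>+x. ennreal (- (f x * ln (f x))) \<partial>lborel) \<le> (\<integral>\<^sup>+x. ennreal \<bar>?b x\<bar> \<partial>lborel)"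
    by (intro nn_integral_mono ennreal_leI)
  also have "\<dots> < \<infinity>"
  proof -
    have "integrable lborel ?b" using assms by auto
    then show ?thesis by (simp add: integrable_iff_bounded)
  qed
  finally show ?thesis .
qed

text \<open>A vanishing second moment would force \<open>x = 0\<close> almost everywhere, although a
  singleton is a null set. Positivity ensures that \<open>gaussian_of f\<close> is a genuine,
  nondegenerate Gaussian.\<close>

lemma second_moment_pos:
  assumes "\<And>x. f x > 0" "integrable lborel (\<lambda>x. x\<^sup>2 * f x)"
  shows "second_moment f > 0"
proof -
  have nonneg: "0 \<le> x\<^sup>2 * f x" for x using assms(1)[of x] by simp
  have "second_moment f \<noteq> 0"
  proof
    assume "second_moment f = 0"
    then have "AE x in lborel. x\<^sup>2 * f x = 0"
      using integral_nonneg_eq_0_iff_AE[OF assms(2)] nonneg by (simp add: second_moment_def)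
    then have "AE x::real in lborel. x = 0"
      by eventually_elim (use assms(1) in \<open>auto simp: less_le\<close>)
    moreover have "AE x::real in lborel. x \<noteq> 0"
      by (rule AE_lborel_singleton)
    ultimately have "AE x::real in lborel. False"
      by eventually_elim simp
    then show False
      by (simp add: AE_iff_null null_sets_def)
  qed
  then show ?thesis
    using integral_nonneg_AE[of "\<lambda>x. x\<^sup>2 * f x" lborel] nonneg
    by (simp add: second_moment_def less_le)
qed

text \<open>The logarithm of the Gaussian is affine in \<open>x\<^sup>2\<close>, so the integral
  depends on \<open>f\<close> only through its mass and second moment. It therefore agrees for
  \<open>f\<close> and for the Gaussian itself.\<close>

lemma integral_ln_normal_density:
  assumes "\<sigma> > 0" and f: "has_bochner_integral lborel f 1"
    and f2: "has_bochner_integral lborel (\<lambda>x. x\<^sup>2 * f x) (\<sigma>\<^sup>2)"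
  shows "has_bochner_integral lborel (\<lambda>x. f x * ln (normal_density 0 \<sigma> x))
    (- (ln (2 * pi * \<sigma>\<^sup>2) + 1) / 2)"
proof -
  have ln_g: "ln (normal_density 0 \<sigma> x) = - ln (2 * pi * \<sigma>\<^sup>2) / 2 - x\<^sup>2 / (2 * \<sigma>\<^sup>2)" for x
  proof -
    have "ln (normal_density 0 \<sigma> x) = ln (1 / sqrt (2 * pi * \<sigma>\<^sup>2)) - x\<^sup>2 / (2 * \<sigma>\<^sup>2)"
      using \<open>\<sigma> > 0\<close> unfolding normal_density_def by (subst ln_mult) auto
    also have "ln (1 / sqrt (2 * pi * \<sigma>\<^sup>2)) = - ln (2 * pi * \<sigma>\<^sup>2) / 2"
      using \<open>\<sigma> > 0\<close> by (subst ln_div) (simp_all add: ln_sqrt del: real_sqrt_mult)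
    finally show ?thesis .
  qed
  have "(\<lambda>x. f x * ln (normal_density 0 \<sigma> x)) =
      (\<lambda>x. (- ln (2 * pi * \<sigma>\<^sup>2) / 2) * f x - (1 / (2 * \<sigma>\<^sup>2)) * (x\<^sup>2 * f x))"
    by (simp only: ln_g) (simp add: algebra_simps)
  moreover have "has_bochner_integral lborel
      (\<lambda>x. (- ln (2 * pi * \<sigma>\<^sup>2) / 2) * f x - (1 / (2 * \<sigma>\<^sup>2)) * (x\<^sup>2 * f x))
      ((- ln (2 * pi * \<sigma>\<^sup>2) / 2) * 1 - (1 / (2 * \<sigma>\<^sup>2)) * \<sigma>\<^sup>2)"
    by (intro has_bochner_integral_diff has_bochner_integral_mult_right f f2)
  moreover have "(- ln (2 * pi * \<sigma>\<^sup>2) / 2) * 1 - (1 / (2 * \<sigma>\<^sup>2)) * \<sigma>\<^sup>2 =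
      - (ln (2 * pi * \<sigma>\<^sup>2) + 1) / 2"
    using \<open>\<sigma> > 0\<close> by (simp add: diff_divide_distrib)
  ultimately show ?thesis
    by (simp only:)
qed

lemma L1_dist_gaussian_of_le:
  assumes pos: "\<And>x. f x > 0" and f: "has_bochner_integral lborel f 1"
    and f2: "integrable lborel (\<lambda>x. x\<^sup>2 * f x)"
  shows "ereal (L1_dist f (gaussian_of f)) \<le>
    ereal 2 * ereal_sqrt (relative_entropy f (gaussian_of f))"
proof -
  define \<sigma> where "\<sigma> = sqrt (second_moment f)"
  define g where "g = normal_density 0 \<sigma>"
  define c where "c = - (ln (2 * pi * \<sigma>\<^sup>2) + 1) / 2"
  have \<sigma>: "\<sigma> > 0" and \<sigma>2: "\<sigma>\<^sup>2 = second_moment f"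
    using second_moment_pos[OF pos f2] by (simp_all add: \<sigma>_def)
  have gauss: "gaussian_of f = g" by (simp add: gaussian_of_def g_def \<sigma>_def)
  have gpos: "g x > 0" for x
    using \<sigma> by (simp add: g_def normal_density_pos)
  have g: "has_bochner_integral lborel g 1"
    using \<sigma> by (simp add: g_def has_bochner_integral_iff)
  \<comment> \<open>This is the even moment of order 2k at k = 1, where the factor (2k)! / (2^k k!)
    equals 1.\<close>
  have g2: "has_bochner_integral lborel (\<lambda>x. x\<^sup>2 * g x) (\<sigma>\<^sup>2)"
    using normal_moment_even[OF \<sigma>, of 0 1] by (simp add: g_def mult.commute)
  have glng: "has_bochner_integral lborel (\<lambda>x. g x * ln (g x)) c"
    using integral_ln_normal_density[OF \<sigma> g g2] by (simp add: g_def c_def)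
  have flng: "has_bochner_integral lborel (\<lambda>x. f x * ln (g x)) c"
    using integral_ln_normal_density[OF \<sigma> f] f2
    by (simp add: g_def c_def has_bochner_integral_iff \<sigma>2 second_moment_def)
  have Hg: "shannon_entropy g = ereal (- c)"
    using shannon_entropy_eq_integral[of g] glng by (simp add: has_bochner_integral_iff)
  show ?thesis
  proof (cases "integrable lborel (\<lambda>x. f x * ln (f x))")
    \<comment> \<open>With finite entropy, the relative entropy is
      \<open>- c - (- b) = b - c\<close>, which is exactly the divergence \<open>K\<close>.\<close>
    case True
    define b where "b = (\<integral>x. f x * ln (f x) \<partial>lborel)"
    have "has_bochner_integral lborel (\<lambda>x. f x * ln (f x) - f x * ln (g x)) (b - c)"
      using True flng by (intro has_bochner_integral_diff) (auto simp: has_bochner_integral_iff b_def)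
    then have "L1_dist f g \<le> 2 * sqrt (b - c)"
      by (rule relative_entropy_ge_L1[OF pos gpos f g])
    then show ?thesis
      by (simp add: gauss relative_entropy_def Hg shannon_entropy_eq_integral[OF True]
          ereal_sqrt_def flip: b_def)
  next
    \<comment> \<open>The negative part of \<open>f ln f\<close> has finite integral, so
      non-integrability must come from the positive part. The entropy is then
      \<open>- \<infinity>\<close>, the relative entropy is \<open>\<infinity>\<close>, and the
      bound is trivial.\<close>
    case False
    have fin: "(\<integral>\<^sup>+x. ennreal (- (f x * ln (f x))) \<partial>lborel) < \<infinity>"
      using f g flng
      by (intro entropy_positive_part_finite[OF pos gpos]) (auto simp: has_bochner_integral_iff)
    have "f \<in> borel_measurable lborel"
      using f by (auto simp: has_bochner_integral_iff)
    then have "(\<integral>\<^sup>+x. ennreal (f x * ln (f x)) \<partial>lborel) = \<infinity>"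
      using False fin by (auto simp: real_integrable_def)
    moreover have "enn2ereal (\<integral>\<^sup>+x. ennreal (- (f x * ln (f x))) \<partial>lborel) - \<infinity> = - \<infinity>"
      using fin by (cases "\<integral>\<^sup>+x. ennreal (- (f x * ln (f x))) \<partial>lborel") auto
    ultimately have "shannon_entropy f = - \<infinity>"
      by (simp add: shannon_entropy_def)
    then show ?thesis
      by (simp add: gauss relative_entropy_def Hg ereal_sqrt_def)
  qed
qed

theorem theorem3p2:
  shows "\<exists>C::real. C > 0 \<and>
    (\<forall>(u :: real \<Rightarrow> real \<Rightarrow> real) (u0 :: real \<Rightarrow> real) (\<Theta>0 :: real).
       DLSS_solution u u0 \<and>
       (\<forall>x. u0 x \<ge> 0) \<and>
       has_bochner_integral lborel u0 1 \<and>
       has_bochner_integral lborel (\<lambda>x. x * u0 x) 0 \<and>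
       has_bochner_integral lborel (\<lambda>x. x\<^sup>2 * u0 x) \<Theta>0 \<and>
       shannon_entropy u0 < \<infinity>
       \<longrightarrow>
       (\<forall>t>0.
          ereal (L1_dist (\<lambda>x. u x t) (gaussian_of (\<lambda>x. u x t)))
            \<le> ereal C * ereal_sqrt
                 (relative_entropy (\<lambda>x. u x t) (gaussian_of (\<lambda>x. u x t)))))"
proof (intro exI[of _ "2::real"] conjI allI impI)
  fix u :: "real \<Rightarrow> real \<Rightarrow> real" and u0 :: "real \<Rightarrow> real" and \<Theta>0 t :: real
  assume "DLSS_solution u u0 \<and> (\<forall>x. u0 x \<ge> 0) \<and> has_bochner_integral lborel u0 1 \<and>
       has_bochner_integral lborel (\<lambda>x. x * u0 x) 0 \<and>
       has_bochner_integral lborel (\<lambda>x. x\<^sup>2 * u0 x) \<Theta>0 \<and> shannon_entropy u0 < \<infinity>"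
    and "t > 0"
  then show "ereal (L1_dist (\<lambda>x. u x t) (gaussian_of (\<lambda>x. u x t)))
      \<le> ereal 2 * ereal_sqrt (relative_entropy (\<lambda>x. u x t) (gaussian_of (\<lambda>x. u x t)))"
    \<comment> \<open>At the fixed time \<open>t > 0\<close>, \<open>DLSS_solution\<close> supplies
      positivity, unit mass and a finite second moment.\<close>
    by (intro L1_dist_gaussian_of_le) (auto simp: DLSS_solution_def)
qed simp

end
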